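(* Let $W$ be the collection of all non-negative (positive semidefinite) Hermitian $(d+1)\times(d+1)$ matrices $B=(B_{jk})_{0\le j,k\le d}$ satisfying $$\sum_{j=0}^d B_{jj}=1\qquad\text{and}\qquad \sum_{k=0}^{d-l}B_{(k+l)k}=0\quad\text{for every integer } l\neq 0,$$ where $B_{jk}$ is interpreted as $0$ if $j$ or $k$ lies outside $\{0,\dots,d\}$. Then the moduli space of unitary equivalence classes of polynomial sphere maps of degree $d$ from the unit circle to $S^{2d+1}\subset\mathbb{C}^{d+1}$ is the quotient space $W/\sim$, where $\sim$ is *-equivalence and the unitary equivalence class of a map $f$ corresponds to the *-equivalence class of its matrix of inner products $B(f)$.
   Context: $\langle\cdot,\cdot\rangle$ is the standard Hermitian inner product on $\mathbb{C}^{d+1}$ (linear in the first slot). A polynomial sphere map of degree $d$ from the circle to $S^{2d+1}$ is a polynomial map $f(z)=\sum_{j=0}^dA_jz^j$ of degree $d$, with $A_j\in\mathbb{C}^{d+1}$, such that $\|f(z)\|=1$ whenever $|z|=1$. For such $f$, $B(f)$ is the $(d+1)\times(d+1)$ matrix with entries $B_{jk}=\langle A_j,A_k\rangle$, $0\le j,k\le d$. Two such maps $f,g$ are unitarily equivalent if $f=U\circ g\circ u$ for some $u\in\mathbf{U}(1)$ (a rotation $z\mapsto e^{i\phi}z$ of the source) and some $U\in\mathbf{U}(d+1)$. Two Hermitian $(d+1)\times(d+1)$ matrices $B,C$ are *-equivalent, written $B\sim C$, if there is a real $\theta$ such that $B_{j(j+m)}=e^{im\theta}C_{j(j+m)}$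 for all integers $j,m$ with $j,j+m\in\{0,\dots,d\}$.
   Formalization: "Of degree d" is read as degree at most d (A_d = 0 allowed): for d ≥ 1 the matrix diag(1,0,…,0) lies in W but forces A_d = 0, so with exact degree d the correspondence would not be onto W/~. *)

theory Defs
  imports "HOL-Analysis.Analysis" "HOL-Computational_Algebra.Polynomial"
begin

definition cinner_vec :: "complex ^ 'n \<Rightarrow> complex ^ 'n \<Rightarrow> complex" where
  "cinner_vec x y = (\<Sum>i\<in>UNIV. x $ i * cnj (y $ i))"

definition conj_transpose :: "complex ^ 'n ^ 'm \<Rightarrow> complex ^ 'm ^ 'n" where
  "conj_transpose U = (\<chi> i j. cnj (U $ j $ i))"

definition unitary_group :: "(complex ^ 'n ^ 'n) set" where
  "unitary_group = {U. conj_transpose U ** U = mat 1 \<and> U ** conj_transpose U = mat 1}"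

(* A polynomial map from the complex numbers to complex n-space is the tuple of its
   component polynomials; pcoeff f j is the vector A_j in f(z) = sum_j A_j z^j. *)

definition peval :: "complex poly ^ 'n \<Rightarrow> complex \<Rightarrow> complex ^ 'n" where
  "peval f z = (\<chi> i. poly (f $ i) z)"

definition pcoeff :: "complex poly ^ 'n \<Rightarrow> nat \<Rightarrow> complex ^ 'n" where
  "pcoeff f j = (\<chi> i. coeff (f $ i) j)"

(* "Degree d" is read as "of the form A_0 + A_1 z + ... + A_d z^d", with A_d = 0 allowed:
   W contains matrices with B_dd = 0 when d > 0, and these are Gram matrices only of maps
   whose leading coefficient A_d vanishes.  For CARD('n) = d + 1 the unit sphere of
   complex ^ 'n is S^(2d+1), and norm is the norm of the Hermitian inner product. *)

definition sphere_maps :: "nat \<Rightarrow> (complex poly ^ 'n) set" where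
  "sphere_maps d =
     {f. (\<forall>i. degree (f $ i) \<le> d) \<and> (\<forall>z. norm z = 1 \<longrightarrow> norm (peval f z) = 1)}"

definition unitary_equivalence :: "nat \<Rightarrow> (complex poly ^ 'n) rel" where
  "unitary_equivalence d =
     {(f, g). f \<in> sphere_maps d \<and> g \<in> sphere_maps d \<and>
        (\<exists>U\<in>unitary_group. \<exists>\<phi>::real. \<forall>z. norm z = 1 \<longrightarrow> peval f z = U *v peval g (cis \<phi> * z))}"

(* A (d+1) x (d+1) matrix with indices in {0..d} is a function on all pairs of integers
   that is 0 whenever an index lies outside {0..d}. *)

definition square_matrices :: "nat \<Rightarrow> (int \<Rightarrow> int \<Rightarrow> complex) set" where
  "square_matrices d = {B. \<forall>j k. j \<notin> {0..int d} \<or> k \<notin> {0..int d} \<longrightarrow> B j k = 0}"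

definition hermitian_matrices :: "nat \<Rightarrow> (int \<Rightarrow> int \<Rightarrow> complex) set" where
  "hermitian_matrices d = {B \<in> square_matrices d. \<forall>j k. B k j = cnj (B j k)}"

(* The quadratic form is automatically real for Hermitian B. *)

definition nonneg_hermitian :: "nat \<Rightarrow> (int \<Rightarrow> int \<Rightarrow> complex) set" where
  "nonneg_hermitian d =
     {B \<in> hermitian_matrices d.
        \<forall>x::int \<Rightarrow> complex. 0 \<le> Re (\<Sum>j\<in>{0..int d}. \<Sum>k\<in>{0..int d}. cnj (x j) * B j k * x k)}"

definition W :: "nat \<Rightarrow> (int \<Rightarrow> int \<Rightarrow> complex) set" where
  "W d = {B \<in> nonneg_hermitian d.
            (\<Sum>j\<in>{0..int d}. B j j) = 1 \<and>
            (\<forall>l::int. l \<noteq> 0 \<longrightarrow> (\<Sum>k\<in>{0..int d - l}. B (k + l) k) = 0)}"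

definition star_equivalent ::
    "nat \<Rightarrow> (int \<Rightarrow> int \<Rightarrow> complex) \<Rightarrow> (int \<Rightarrow> int \<Rightarrow> complex) \<Rightarrow> bool" where
  "star_equivalent d B C \<longleftrightarrow>
     (\<exists>\<theta>::real. \<forall>j m::int. j \<in> {0..int d} \<and> j + m \<in> {0..int d} \<longrightarrow>
        B j (j + m) = exp (\<i> * of_int m * of_real \<theta>) * C j (j + m))"

definition star_equivalence :: "nat \<Rightarrow> (int \<Rightarrow> int \<Rightarrow> complex) rel" where
  "star_equivalence d = {(B, C). B \<in> W d \<and> C \<in> W d \<and> star_equivalent d B C}"

definition gram_matrix :: "nat \<Rightarrow> complex poly ^ 'n \<Rightarrow> int \<Rightarrow> int \<Rightarrow> complex" where
  "gram_matrix d f j k =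
     (if j \<in> {0..int d} \<and> k \<in> {0..int d}
      then cinner_vec (pcoeff f (nat j)) (pcoeff f (nat k)) else 0)"

(* The topology of convergence of all coefficients. *)

definition sphere_map_topology :: "nat \<Rightarrow> (complex poly ^ 'n) topology" where
  "sphere_map_topology d = pullback_topology (sphere_maps d) pcoeff euclidean"

definition quotient_topology :: "'a topology \<Rightarrow> 'a rel \<Rightarrow> 'a set topology" where
  "quotient_topology X r =
     topology (\<lambda>S. S \<subseteq> topspace X // r \<and> openin X {x \<in> topspace X. r `` {x} \<in> S})"

lemma openin_quotient_topology:
  "openin (quotient_topology X r) S \<longleftrightarrow>
     S \<subseteq> topspace X // r \<and> openin X {x \<in> topspace X. r `` {x} \<in> S}"
proof -
  have "istopology (\<lambda>S. S \<subseteq> topspace X // r \<and> openin X {x \<in> topspace X. r `` {x} \<in> S})"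
    unfolding istopology_def
  proof (intro conjI allI impI)
    fix S T
    assume S: "S \<subseteq> topspace X // r \<and> openin X {x \<in> topspace X. r `` {x} \<in> S}"
      and T: "T \<subseteq> topspace X // r \<and> openin X {x \<in> topspace X. r `` {x} \<in> T}"
    show "S \<inter> T \<subseteq> topspace X // r" using S by blast
    have "{x \<in> topspace X. r `` {x} \<in> S \<inter> T} =
          {x \<in> topspace X. r `` {x} \<in> S} \<inter> {x \<in> topspace X. r `` {x} \<in> T}" by blast
    then show "openin X {x \<in> topspace X. r `` {x} \<in> S \<inter> T}" using S T by auto
  next
    fix K
    assume K: "\<forall>S\<in>K. S \<subseteq> topspace X // r \<and> openin X {x \<in> topspace X. r `` {x} \<in> S}"
    show "\<Union>K \<subseteq> topspace X // r" using K by blast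
    have "{x \<in> topspace X. r `` {x} \<in> \<Union>K} = (\<Union>S\<in>K. {x \<in> topspace X. r `` {x} \<in> S})" by blast
    then show "openin X {x \<in> topspace X. r `` {x} \<in> \<Union>K}" using K by auto
  qed
  then show ?thesis by (simp add: quotient_topology_def topology_inverse')
qed

lemma topspace_quotient_topology [simp]: "topspace (quotient_topology X r) = topspace X // r"
proof
  show "topspace (quotient_topology X r) \<subseteq> topspace X // r"
    using openin_quotient_topology by blast
  have "{x \<in> topspace X. r `` {x} \<in> topspace X // r} = topspace X"
    by (auto simp: quotient_def)
  then have "openin (quotient_topology X r) (topspace X // r)"
    by (simp add: openin_quotient_topology)
  then show "topspace X // r \<subseteq> topspace (quotient_topology X r)"
    by (rule openin_subset)
qed

lemma quotient_map_quotient_topology: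
  "quotient_map X (quotient_topology X r) (\<lambda>x. r `` {x})"
  unfolding quotient_map_def by (auto simp: openin_quotient_topology quotient_def)

lemma topspace_sphere_map_topology [simp]: "topspace (sphere_map_topology d) = sphere_maps d"
  by (simp add: sphere_map_topology_def topspace_pullback_topology)

lemma conj_transpose_mult: "conj_transpose (A ** B) = conj_transpose B ** conj_transpose A"
  by (simp add: conj_transpose_def matrix_matrix_mult_def vec_eq_iff mult.commute)

lemma conj_transpose_conj_transpose [simp]: "conj_transpose (conj_transpose A) = A"
  by (simp add: conj_transpose_def vec_eq_iff)

lemma equiv_unitary_equivalence:
  "equiv (sphere_maps d) (unitary_equivalence d :: (complex poly ^ 'n) rel)"
proof (rule equivI)
  show "(unitary_equivalence d :: (complex poly ^ 'n) rel) \<subseteq> sphere_maps d \<times> sphere_maps d"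
    by (auto simp: unitary_equivalence_def)
  show "refl_on (sphere_maps d) (unitary_equivalence d :: (complex poly ^ 'n) rel)"
  proof (rule refl_onI)
    fix f :: "complex poly ^ 'n" assume "f \<in> sphere_maps d"
    moreover have "mat 1 \<in> (unitary_group :: (complex ^ 'n ^ 'n) set)"
    proof -
      have "conj_transpose (mat 1 :: complex ^ 'n ^ 'n) = mat 1"
        by (auto simp: conj_transpose_def mat_def vec_eq_iff)
      then show ?thesis by (simp add: unitary_group_def)
    qed
    moreover have "\<forall>z. norm z = 1 \<longrightarrow> peval f z = mat 1 *v peval f (cis 0 * z)" by simp
    ultimately show "(f, f) \<in> unitary_equivalence d"
      unfolding unitary_equivalence_def by blast
  qed
  show "sym (unitary_equivalence d :: (complex poly ^ 'n) rel)"
  proof (rule symI)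
    fix f g :: "complex poly ^ 'n" assume "(f, g) \<in> unitary_equivalence d"
    then obtain U \<phi> where fg: "f \<in> sphere_maps d" "g \<in> sphere_maps d" and U: "U \<in> unitary_group"
      and e: "\<And>z. norm z = 1 \<Longrightarrow> peval f z = U *v peval g (cis \<phi> * z)"
      unfolding unitary_equivalence_def by blast
    have U': "conj_transpose U \<in> unitary_group" using U by (simp add: unitary_group_def)
    have "peval g z = conj_transpose U *v peval f (cis (- \<phi>) * z)" if "norm z = 1" for z
    proof -
      have "peval f (cis (- \<phi>) * z) = U *v peval g (cis \<phi> * (cis (- \<phi>) * z))"
        using that by (intro e) (simp add: norm_mult)
      also have "cis \<phi> * (cis (- \<phi>) * z) = z"
        by (simp add: mult.assoc [symmetric] cis_mult)
      finally show ?thesis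
        using U by (simp add: unitary_group_def matrix_vector_mul_assoc)
    qed
    with fg U' show "(g, f) \<in> unitary_equivalence d"
      unfolding unitary_equivalence_def by blast
  qed
  show "trans (unitary_equivalence d :: (complex poly ^ 'n) rel)"
  proof (rule transI)
    fix f g h :: "complex poly ^ 'n"
    assume "(f, g) \<in> unitary_equivalence d" "(g, h) \<in> unitary_equivalence d"
    then obtain U \<phi> V \<psi> where fh: "f \<in> sphere_maps d" "h \<in> sphere_maps d"
      and U: "U \<in> unitary_group" and V: "V \<in> unitary_group"
      and e: "\<And>z. norm z = 1 \<Longrightarrow> peval f z = U *v peval g (cis \<phi> * z)"
      and e': "\<And>z. norm z = 1 \<Longrightarrow> peval g z = V *v peval h (cis \<psi> * z)"
      unfolding unitary_equivalence_def by blast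
    have UV: "U ** V \<in> unitary_group"
    proof -
      have "conj_transpose V ** conj_transpose U ** (U ** V)
            = conj_transpose V ** (conj_transpose U ** U) ** V"
        by (simp add: matrix_mul_assoc)
      moreover have "U ** V ** (conj_transpose V ** conj_transpose U)
            = U ** (V ** conj_transpose V) ** conj_transpose U"
        by (simp add: matrix_mul_assoc)
      ultimately show ?thesis
        using U V by (simp add: unitary_group_def conj_transpose_mult)
    qed
    have "peval f z = (U ** V) *v peval h (cis (\<phi> + \<psi>) * z)" if z: "norm z = 1" for z
    proof -
      have "peval g (cis \<phi> * z) = V *v peval h (cis \<psi> * (cis \<phi> * z))"
        using z by (intro e') (simp add: norm_mult)
      also have "cis \<psi> * (cis \<phi> * z) = cis (\<phi> + \<psi>) * z"
        by (simp add: mult.assoc [symmetric] cis_mult add.commute)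
      finally show ?thesis using e [OF z] by (simp add: matrix_vector_mul_assoc)
    qed
    with fh UV show "(f, h) \<in> unitary_equivalence d"
      unfolding unitary_equivalence_def by blast
  qed
qed

lemma equiv_star_equivalence: "equiv (W d) (star_equivalence d)"
proof (rule equivI)
  show "star_equivalence d \<subseteq> W d \<times> W d" by (auto simp: star_equivalence_def)
  show "refl_on (W d) (star_equivalence d)"
  proof (rule refl_onI)
    fix B assume "B \<in> W d"
    moreover have "star_equivalent d B B"
      unfolding star_equivalent_def by (rule exI [of _ 0]) simp
    ultimately show "(B, B) \<in> star_equivalence d" by (simp add: star_equivalence_def)
  qed
  show "sym (star_equivalence d)"
  proof (rule symI)
    fix B C assume "(B, C) \<in> star_equivalence d"
    then obtain \<theta> :: real where BC: "B \<in> W d" "C \<in> W d"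
      and e: "\<And>j m. j \<in> {0..int d} \<Longrightarrow> j + m \<in> {0..int d} \<Longrightarrow>
                B j (j + m) = exp (\<i> * of_int m * of_real \<theta>) * C j (j + m)"
      unfolding star_equivalence_def star_equivalent_def by blast
    have "C j (j + m) = exp (\<i> * of_int m * of_real (- \<theta>)) * B j (j + m)"
      if "j \<in> {0..int d}" "j + m \<in> {0..int d}" for j m
      using e [OF that] by (simp add: mult.assoc [symmetric] exp_add [symmetric])
    with BC show "(C, B) \<in> star_equivalence d"
      unfolding star_equivalence_def star_equivalent_def by blast
  qed
  show "trans (star_equivalence d)"
  proof (rule transI)
    fix A B C assume "(A, B) \<in> star_equivalence d" "(B, C) \<in> star_equivalence d"
    then obtain \<theta> \<eta> :: real where AC: "A \<in> W d" "C \<in> W d"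
      and e: "\<And>j m. j \<in> {0..int d} \<Longrightarrow> j + m \<in> {0..int d} \<Longrightarrow>
                A j (j + m) = exp (\<i> * of_int m * of_real \<theta>) * B j (j + m)"
      and e': "\<And>j m. j \<in> {0..int d} \<Longrightarrow> j + m \<in> {0..int d} \<Longrightarrow>
                B j (j + m) = exp (\<i> * of_int m * of_real \<eta>) * C j (j + m)"
      unfolding star_equivalence_def star_equivalent_def by blast
    have "A j (j + m) = exp (\<i> * of_int m * of_real (\<theta> + \<eta>)) * C j (j + m)"
      if "j \<in> {0..int d}" "j + m \<in> {0..int d}" for j m
      using e [OF that] e' [OF that] by (simp add: distrib_left exp_add mult.assoc)
    with AC show "(A, C) \<in> star_equivalence d"
      unfolding star_equivalence_def star_equivalent_def by blast
  qed
qed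

end

theory Submission
  imports Defs
begin

text \<open>
  The matrix of inner products of a map forgets exactly the action of the unitary group of the
  target. On the circle the squared norm of \<open>f\<close> is a trigonometric polynomial whose
  Fourier coefficients are the sums along the diagonals of the Gram matrix, so having norm 1 there
  is the same as the linear conditions in the definition of \<open>W\<close>
  (\<open>sphere_map_iff_gram_matrix_in_W\<close>). A positive semidefinite matrix of size
  \<open>d + 1\<close> is the Gram matrix of \<open>d + 1\<close> vectors in a space of dimension
  \<open>d + 1\<close>, so every element of \<open>W\<close> occurs (\<open>gram_matrix_surj\<close>).

  Two families of vectors with the same Gram matrix differ by a unitary matrix
  (\<open>equal_gram_imp_unitary\<close>). Rotating the source by the angle \<open>\<phi>\<close>
  multiplies the coefficient with index \<open>j\<close> by \<open>cis (j * \<phi>)\<close>, hence the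
  entry \<open>(j, k)\<close> of the Gram matrix by \<open>cis ((j - k) * \<phi>)\<close>; this is
  *-equivalence with \<open>\<theta> = - \<phi>\<close>. So unitary equivalence of maps is precisely
  *-equivalence of their Gram matrices (\<open>unitary_equivalence_iff_star_equivalence\<close>).

  For the topology, the trace condition bounds all coefficients, so the space of sphere maps is
  compact. The Gram matrix depends continuously on the map, and \<open>W\<close> is Hausdorff, so the
  Gram matrix is a quotient map onto \<open>W\<close> (\<open>quotient_map_gram_matrix\<close>).
  Both the moduli space and \<open>W\<close> modulo *-equivalence are then quotients of the space of
  sphere maps with the same fibres, and such quotients are homeomorphic
  (\<open>quotient_maps_same_fibres_homeomorphic\<close>).
\<close>

section \<open>Hermitian inner product and unitary matrices\<close>

lemma cinner_vec_diff_left: "cinner_vec (x - y) z = cinner_vec x z - cinner_vec y z"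
  by (simp add: cinner_vec_def left_diff_distrib sum_subtractf)

lemma cinner_vec_diff_right: "cinner_vec x (y - z) = cinner_vec x y - cinner_vec x z"
  by (simp add: cinner_vec_def right_diff_distrib sum_subtractf)

lemma cinner_vec_scale_left: "cinner_vec (c *s x) y = c * cinner_vec x y"
  by (simp add: cinner_vec_def sum_distrib_left mult.assoc)

lemma cinner_vec_scale_right: "cinner_vec x (c *s y) = cnj c * cinner_vec x y"
  by (simp add: cinner_vec_def sum_distrib_left algebra_simps)

lemma cinner_vec_sum_left: "cinner_vec (\<Sum>i\<in>I. f i) y = (\<Sum>i\<in>I. cinner_vec (f i) y)"
  unfolding cinner_vec_def by (simp add: sum_distrib_right) (rule sum.swap)

lemma cinner_vec_sum_right: "cinner_vec x (\<Sum>i\<in>I. f i) = (\<Sum>i\<in>I. cinner_vec x (f i))"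
  unfolding cinner_vec_def by (simp add: sum_distrib_left) (rule sum.swap)

lemma cinner_vec_commute: "cinner_vec y x = cnj (cinner_vec x y)"
  by (simp add: cinner_vec_def mult.commute)

lemma cinner_vec_self: "cinner_vec x x = of_real ((norm x)\<^sup>2)"
proof -
  have "(norm x)\<^sup>2 = (\<Sum>i\<in>UNIV. (norm (x $ i))\<^sup>2)"
    by (simp add: norm_vec_def L2_set_def sum_nonneg)
  then show ?thesis by (simp only: cinner_vec_def complex_norm_square of_real_sum)
qed

lemma cinner_vec_matrix_left:
  "cinner_vec (U *v x) y = cinner_vec x (conj_transpose U *v y)"
  unfolding cinner_vec_def matrix_vector_mult_def conj_transpose_def
  by (simp add: sum_distrib_left sum_distrib_right) (subst sum.swap, simp add: ac_simps)

lemma cinner_vec_linear_combinations: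
  "cinner_vec (\<Sum>j\<in>I. a j *s v j) (\<Sum>k\<in>J. b k *s w k) =
     (\<Sum>j\<in>I. \<Sum>k\<in>J. a j * cnj (b k) * cinner_vec (v j) (w k))"
  by (simp add: cinner_vec_sum_left)
    (simp add: cinner_vec_sum_right cinner_vec_scale_left cinner_vec_scale_right
      sum_distrib_left ac_simps)

lemma unitary_group_cinner_vec:
  assumes "U \<in> unitary_group"
  shows "cinner_vec (U *v x) (U *v y) = cinner_vec x y"
  using assms by (simp add: cinner_vec_matrix_left matrix_vector_mul_assoc unitary_group_def)

lemma unitary_group_mult:
  assumes "U \<in> unitary_group" "V \<in> unitary_group"
  shows "U ** V \<in> unitary_group"
proof -
  have "conj_transpose V ** conj_transpose U ** (U ** V)
      = conj_transpose V ** (conj_transpose U ** U) ** V"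
    by (simp add: matrix_mul_assoc)
  moreover have "U ** V ** (conj_transpose V ** conj_transpose U)
      = U ** (V ** conj_transpose V) ** conj_transpose U"
    by (simp add: matrix_mul_assoc)
  ultimately show ?thesis
    using assms by (simp add: unitary_group_def conj_transpose_mult)
qed

lemma mat_1_in_unitary_group: "mat 1 \<in> unitary_group"
proof -
  have "conj_transpose (mat 1 :: complex ^ 'n ^ 'n) = mat 1"
    by (auto simp: conj_transpose_def mat_def vec_eq_iff)
  then show ?thesis by (simp add: unitary_group_def)
qed

section \<open>Families with equal Gram matrices\<close>

text \<open>
  The operator \<open>x \<mapsto> x - c \<langle>x, u\<rangle> u\<close>. The factor \<open>c\<close>
  is left free because over the complex numbers the reflection that carries one given vector to
  another needs a value of \<open>c\<close> that is in general not real.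
\<close>

definition complex_reflection :: "complex \<Rightarrow> complex ^ 'n \<Rightarrow> complex ^ 'n ^ 'n" where
  "complex_reflection c u = (\<chi> i j. (if i = j then 1 else 0) - c * u $ i * cnj (u $ j))"

lemma complex_reflection_apply:
  "complex_reflection c u *v x = x - (c * cinner_vec x u) *s u"
proof -
  have "(complex_reflection c u *v x) $ i = x $ i - c * cinner_vec x u * u $ i" for i
  proof -
    have "(complex_reflection c u *v x) $ i
        = (\<Sum>j\<in>UNIV. (if i = j then x $ j else 0) - c * u $ i * (x $ j * cnj (u $ j)))"
      unfolding complex_reflection_def matrix_vector_mult_def
      by (simp, intro sum.cong) (auto simp: algebra_simps)
    also have "\<dots> = x $ i - c * u $ i * cinner_vec x u"
      by (simp add: sum_subtractf cinner_vec_def sum_distrib_left)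
    finally show ?thesis by (simp add: ac_simps)
  qed
  then show ?thesis by (simp add: vec_eq_iff)
qed

lemma conj_transpose_complex_reflection:
  "conj_transpose (complex_reflection c u) = complex_reflection (cnj c) u"
  by (auto simp: conj_transpose_def complex_reflection_def vec_eq_iff)

lemma complex_reflection_mult:
  assumes "a + b = a * b * cinner_vec u u"
  shows "complex_reflection a u ** complex_reflection b u = mat 1"
proof -
  have "complex_reflection a u *v (complex_reflection b u *v x) = x" for x
  proof -
    let ?s = "cinner_vec x u"
    have "complex_reflection a u *v (complex_reflection b u *v x)
        = x - ((a + b - a * b * cinner_vec u u) * ?s) *s u"
      by (simp add: complex_reflection_apply cinner_vec_diff_left cinner_vec_scale_left
          vec_eq_iff algebra_simps)
    then show ?thesis using assms by simp
  qed
  then show ?thesis by (simp add: matrix_eq matrix_vector_mul_assoc [symmetric])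
qed

text \<open>
  The reflection along \<open>u = v - w\<close> sends \<open>v\<close> to \<open>w\<close> as soon as
  \<open>c = 1 / \<langle>v, u\<rangle>\<close>, and it fixes everything orthogonal to \<open>u\<close>.
  For this \<open>c\<close>, unitarity is the identity
  \<open>\<langle>u, u\<rangle> = 2 Re \<langle>v, u\<rangle>\<close>, which is the equality of the norms of
  \<open>v\<close> and \<open>w\<close>. That identity also covers the division by zero: if
  \<open>\<langle>v, u\<rangle> = 0\<close> then \<open>v = w\<close> and the reflection is the identity.
\<close>

lemma unitary_reflection_exists:
  fixes v w :: "complex ^ 'n"
  assumes "cinner_vec v v = cinner_vec w w"
  obtains R where "R \<in> unitary_group" "R *v v = w"
    "\<And>x. cinner_vec x v = cinner_vec x w \<Longrightarrow> R *v x = x"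
proof
  define u where "u = v - w"
  define a where "a = cinner_vec v u"
  let ?R = "complex_reflection (inverse a) u"
  have uu: "cinner_vec u u = a + cnj a"
    using assms cinner_vec_commute [of w v] cinner_vec_commute [of v v] unfolding a_def u_def
    by (simp add: cinner_vec_diff_left cinner_vec_diff_right)
  have u0: "u = 0" if "a = 0"
    using uu that by (simp add: cinner_vec_self)
  have "inverse a + cnj (inverse a) = inverse a * cnj (inverse a) * cinner_vec u u"
    by (cases "a = 0") (simp_all add: uu field_simps)
  then show "?R \<in> unitary_group"
    by (simp add: unitary_group_def conj_transpose_complex_reflection complex_reflection_mult
        add.commute mult.commute)
  show "?R *v v = w"
  proof (cases "a = 0")
    case True
    with u0 show ?thesis by (simp add: complex_reflection_apply u_def)
  next
    case False
    then show ?thesis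
      by (simp add: complex_reflection_apply a_def [symmetric]) (simp add: u_def)
  qed
  show "?R *v x = x" if "cinner_vec x v = cinner_vec x w" for x
    using that by (simp add: complex_reflection_apply u_def cinner_vec_diff_right)
qed

text \<open>
  The unitary matrix is built one vector at a time as a product of reflections. Once the vectors
  indexed by \<open>I\<close> are matched, the image of the next vector \<open>v a\<close> and its target
  \<open>w a\<close> have equal inner products with all \<open>w i\<close>, so the reflection that
  carries the image to the target leaves the vectors already matched in place. This avoids extending an
  isometry from a subspace to the whole space.
\<close>

lemma equal_gram_imp_unitary:
  fixes v w :: "'i \<Rightarrow> complex ^ 'n"
  assumes "finite I"
    and "\<And>i j. i \<in> I \<Longrightarrow> j \<in> I \<Longrightarrow> cinner_vec (v i) (v j) = cinner_vec (w i) (w j)"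
  shows "\<exists>U\<in>unitary_group. \<forall>i\<in>I. U *v v i = w i"
  using assms
proof (induction I rule: finite_induct)
  case empty
  show ?case using mat_1_in_unitary_group by blast
next
  case (insert a I)
  then obtain U where U: "U \<in> unitary_group" "\<And>i. i \<in> I \<Longrightarrow> U *v v i = w i"
    by blast
  have "cinner_vec (U *v v a) (U *v v a) = cinner_vec (w a) (w a)"
    using insert.prems U(1) by (simp add: unitary_group_cinner_vec)
  then obtain R where R: "R \<in> unitary_group" "R *v (U *v v a) = w a"
    "\<And>x. cinner_vec x (U *v v a) = cinner_vec x (w a) \<Longrightarrow> R *v x = x"
    by (rule unitary_reflection_exists) blast
  have "R *v (U *v v i) = w i" if "i \<in> I" for i
  proof -
    have "cinner_vec (w i) (U *v v a) = cinner_vec (v i) (v a)"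
      using U that unitary_group_cinner_vec by metis
    also have "\<dots> = cinner_vec (w i) (w a)" using insert.prems that by simp
    finally show ?thesis using R(3) U(2) that by simp
  qed
  then have "\<forall>i\<in>insert a I. (R ** U) *v v i = w i"
    using R(2) by (simp add: matrix_vector_mul_assoc [symmetric])
  then show ?case using unitary_group_mult [OF R(1) U(1)] by blast
qed

section \<open>Positive semidefinite matrices are Gram matrices\<close>

text \<open>
  Cholesky factorization, by adding one index at a time. Subtracting from \<open>B\<close> the rank-one
  matrix built from its column \<open>a\<close> leaves the Schur complement on \<open>I\<close>. It is
  again positive semidefinite, because its quadratic form is the minimum of that of \<open>B\<close>
  over the coordinate \<open>a\<close>. If the pivot is zero, positivity forces the whole column to
  vanish, and with \<open>x / 0 = 0\<close> the same formulas remain valid. The factor is indexed by the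
  same set as the matrix, which bounds the dimension needed for the vectors.
\<close>

lemma psd_imp_gram:
  fixes B :: "'i \<Rightarrow> 'i \<Rightarrow> complex"
  assumes "finite I"
    and "\<And>j k. j \<in> I \<Longrightarrow> k \<in> I \<Longrightarrow> B k j = cnj (B j k)"
    and "\<And>x. 0 \<le> Re (\<Sum>j\<in>I. \<Sum>k\<in>I. cnj (x j) * B j k * x k)"
  shows "\<exists>L::'i \<Rightarrow> 'i \<Rightarrow> complex. \<forall>j\<in>I. \<forall>k\<in>I. B j k = (\<Sum>i\<in>I. L j i * cnj (L k i))"
  using assms
proof (induction I arbitrary: B rule: finite_induct)
  case empty
  show ?case by simp
next
  case (insert a I B)
  define b where "b = Re (B a a)"
  define Q where "Q x = (\<Sum>j\<in>I. \<Sum>k\<in>I. cnj (x j) * B j k * x k)" for x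
  define s where "s x = (\<Sum>k\<in>I. B a k * x k)" for x
  have herm: "B k j = cnj (B j k)" if "j \<in> insert a I" "k \<in> insert a I" for j k
    using insert.prems(1) that by blast
  have Baa: "B a a = of_real b"
    using herm [of a a] by (simp add: b_def complex_eq_iff)
  have s': "(\<Sum>j\<in>I. cnj (x j) * B j a) = cnj (s x)" for x
    unfolding s_def cnj_sum by (intro sum.cong refl) (simp add: herm [of a] mult.commute)
  \<comment> \<open>The quadratic form at the vector with coordinate \<open>t\<close> at \<open>a\<close> and \<open>x\<close> on \<open>I\<close>.\<close>
  have expand: "0 \<le> (norm t)\<^sup>2 * b + 2 * Re (cnj t * s x) + Re (Q x)" for x t
  proof -
    let ?y = "x(a := t)"
    have eqI: "(\<Sum>j\<in>I. F j (?y j)) = (\<Sum>j\<in>I. F j (x j))" for F :: "'i \<Rightarrow> complex \<Rightarrow> complex"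
      using insert.hyps by (intro sum.cong) auto
    have eqII: "(\<Sum>j\<in>I. \<Sum>k\<in>I. cnj (?y j) * B j k * ?y k) = Q x"
      unfolding Q_def using insert.hyps by (intro sum.cong refl) auto
    have "(\<Sum>j\<in>insert a I. \<Sum>k\<in>insert a I. cnj (?y j) * B j k * ?y k)
        = cnj t * B a a * t + (\<Sum>k\<in>I. cnj t * B a k * x k)
          + (\<Sum>j\<in>I. cnj (x j) * B j a * t) + Q x"
      using insert.hyps eqII eqI [of "\<lambda>j y. cnj y * B j a * t"] eqI [of "\<lambda>k y. cnj t * B a k * y"]
      by (simp add: sum.distrib del: fun_upd_apply) simp
    also have "(\<Sum>k\<in>I. cnj t * B a k * x k) = cnj t * s x"
      by (simp add: s_def sum_distrib_left mult.assoc)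
    also have "(\<Sum>j\<in>I. cnj (x j) * B j a * t) = cnj (cnj t * s x)"
      by (simp add: s' [symmetric] sum_distrib_left ac_simps)
    also have "cnj t * B a a * t = of_real ((norm t)\<^sup>2 * b)"
      by (simp add: Baa complex_norm_square del: of_real_power)
    finally show ?thesis using insert.prems(2) [of ?y] by simp
  qed
  have b0: "0 \<le> b"
    using expand [of 1 "\<lambda>_. 0"] by (simp add: s_def Q_def)
  have col0: "B a k = 0" if "b = 0" "k \<in> I" for k
  proof (rule ccontr)
    assume nz: "B a k \<noteq> 0"
    define e where "e = (\<lambda>j. if j = k then 1 else 0 :: complex)"
    have "s e = (\<Sum>i\<in>I. if i = k then B a i else 0)"
      unfolding s_def e_def by (intro sum.cong) auto
    then have "s e = B a k" using that(2) insert.hyps(1) by simp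
    have "Q e = (\<Sum>i\<in>I. if i = k then \<Sum>j\<in>I. if j = k then B i j else 0 else 0)"
      unfolding Q_def e_def by (intro sum.cong) (auto intro!: sum.cong sum.neutral)
    then have "Q e = B k k" using that(2) insert.hyps(1) by simp
    have cross: "Re (cnj (- of_real r * B a k) * s e) = - r * (norm (B a k))\<^sup>2" for r
      by (simp add: \<open>s e = B a k\<close> cmod_power2) (simp add: power2_eq_square algebra_simps)
    have "0 \<le> - 2 * r * (norm (B a k))\<^sup>2 + Re (B k k)" for r
      using expand [of "- of_real r * B a k" e]
      unfolding that(1) cross \<open>Q e = B k k\<close> by (simp add: mult.assoc)
    \<comment> \<open>The bound is linear in \<open>r\<close> with nonzero slope; at this \<open>r\<close> its right-hand side is \<open>-1\<close>.\<close>
    from this [of "(Re (B k k) + 1) / (2 * (norm (B a k))\<^sup>2)"] nz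
    show False by (simp add: field_simps)
  qed
  define B' where "B' j k = B j k - B j a * B a k / of_real b" for j k
  have "\<exists>L::'i \<Rightarrow> 'i \<Rightarrow> complex. \<forall>j\<in>I. \<forall>k\<in>I. B' j k = (\<Sum>i\<in>I. L j i * cnj (L k i))"
  proof (rule insert.IH)
    show "B' k j = cnj (B' j k)" if "j \<in> I" "k \<in> I" for j k
      using that by (simp add: B'_def herm [of j k] herm [of a] mult.commute)
    show "0 \<le> Re (\<Sum>j\<in>I. \<Sum>k\<in>I. cnj (x j) * B' j k * x k)" for x
    proof -
      have "(\<Sum>j\<in>I. \<Sum>k\<in>I. cnj (x j) * B' j k * x k)
          = Q x - (\<Sum>j\<in>I. cnj (x j) * B j a) * (\<Sum>k\<in>I. B a k * x k) / of_real b"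
        unfolding B'_def Q_def sum_product sum_divide_distrib sum_subtractf [symmetric]
        by (intro sum.cong refl) (simp add: algebra_simps)
      also have "\<dots> = Q x - of_real ((norm (s x))\<^sup>2 / b)"
        unfolding s' s_def [symmetric] of_real_divide complex_norm_square
        by (simp add: mult.commute)
      finally have *: "Re (\<Sum>j\<in>I. \<Sum>k\<in>I. cnj (x j) * B' j k * x k)
          = Re (Q x) - (norm (s x))\<^sup>2 / b" by simp
      have cross: "Re (cnj (- s x / of_real b) * s x) = - ((norm (s x))\<^sup>2 / b)"
        by (simp add: cmod_power2) (simp add: power2_eq_square add_divide_distrib)
      have sqr: "(norm (- s x / of_real b))\<^sup>2 * b = (norm (s x))\<^sup>2 / b"
        using b0 by (simp add: norm_divide power2_eq_square)
      show ?thesis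
        \<comment> \<open>This value of the coordinate \<open>a\<close> minimizes the quadratic form.\<close>
        using expand [of "- s x / of_real b" x] unfolding * cross sqr by simp
    qed
  qed
  then obtain L where L: "\<And>j k. j \<in> I \<Longrightarrow> k \<in> I \<Longrightarrow> B' j k = (\<Sum>i\<in>I. L j i * cnj (L k i))"
    by blast
  define M where "M j i = (if i = a then B j a / of_real (sqrt b) else if j = a then 0 else L j i)"
    for j i
  have sq: "complex_of_real (sqrt b) * complex_of_real (sqrt b) = of_real b"
    using b0 by (simp flip: of_real_mult)
  have MI: "(\<Sum>i\<in>I. M j i * cnj (M k i)) = (if j = a \<or> k = a then 0 else \<Sum>i\<in>I. L j i * cnj (L k i))" for j k
    using insert.hyps(2) by (auto simp: M_def intro!: sum.neutral sum.cong)
  have "B j k = (\<Sum>i\<in>insert a I. M j i * cnj (M k i))" if jk: "j \<in> insert a I" "k \<in> insert a I" for j k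
  proof -
    have "(\<Sum>i\<in>insert a I. M j i * cnj (M k i))
        = B j a * B a k / of_real b + (if j = a \<or> k = a then 0 else B' j k)"
    proof -
      have "M j a * cnj (M k a) = B j a * B a k / of_real b"
        using herm [of k a] jk by (simp add: M_def sq)
      moreover have "(\<Sum>i\<in>I. M j i * cnj (M k i)) = (if j = a \<or> k = a then 0 else B' j k)"
        using jk by (auto simp: MI L)
      ultimately show ?thesis using insert.hyps by simp
    qed
    also have "\<dots> = B j k"
    proof (cases "j = a \<or> k = a")
      case True
      then show ?thesis
        using jk col0 Baa herm [of a j] by (cases "b = 0") auto
    qed (simp add: B'_def)
    finally show ?thesis ..
  qed
  then show ?case by blast
qed

section \<open>Sphere maps and their Gram matrices\<close>

lemma poly_eqI_circle:
  fixes p q :: "complex poly"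
  assumes "\<And>z. norm z = 1 \<Longrightarrow> poly p z = poly q z"
  shows "p = q"
proof (rule ccontr)
  assume "p \<noteq> q"
  then have "finite {z. poly (p - q) z = 0}" by (intro poly_roots_finite) simp
  moreover have "sphere 0 1 \<subseteq> {z. poly (p - q) z = 0}" using assms by auto
  ultimately have "finite (sphere (0::complex) 1)" by (rule rev_finite_subset)
  then show False using connected_uncountable [of "sphere (0::complex) 1" 1 "-1"] connected_sphere [of "0::complex" 1]
    by (simp add: uncountable_infinite)
qed

text \<open>
  On the circle \<open>cnj z = 1 / z\<close>, so multiplying the form by \<open>z ^ d\<close> turns it into an
  ordinary polynomial \<open>P\<close>, whose coefficient at \<open>d + l\<close> is the sum of
  \<open>B\<close> along the diagonal \<open>j - k = l\<close>. The form is constantly 1 exactly if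
  \<open>P\<close> and \<open>z ^ d\<close> agree on an infinite set, that is, coefficientwise.
\<close>

lemma circle_form_eq_1_iff:
  assumes B: "B \<in> square_matrices d"
  shows "(\<forall>z. norm z = 1 \<longrightarrow>
            (\<Sum>j\<in>{0..int d}. \<Sum>k\<in>{0..int d}. z ^ nat j * cnj (z ^ nat k) * B j k) = 1) \<longleftrightarrow>
         (\<Sum>j\<in>{0..int d}. B j j) = 1 \<and>
         (\<forall>l::int. l \<noteq> 0 \<longrightarrow> (\<Sum>k\<in>{0..int d - l}. B (k + l) k) = 0)"
    (is "(\<forall>z. norm z = 1 \<longrightarrow> ?F z = 1) \<longleftrightarrow> ?rhs")
proof -
  let ?I = "{0..int d}"
  define P where "P = (\<Sum>j\<in>?I. \<Sum>k\<in>?I. monom (B j k) (nat (int d + j - k)))"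
  define c where "c l = (\<Sum>k\<in>{0..int d - l}. B (k + l) k)" for l
  have out: "B j k = 0" if "j \<notin> ?I \<or> k \<notin> ?I" for j k
    using B that by (auto simp: square_matrices_def)
  have polyP: "poly P z = z ^ d * ?F z" if z: "norm z = 1" for z
  proof -
    have "z ^ nat (int d + j - k) = z ^ d * (z ^ nat j * cnj (z ^ nat k))"
      if "j \<in> ?I" "k \<in> ?I" for j k
    proof -
      have "nat (int d + j - k) = (d - nat k) + nat j" and "d = (d - nat k) + nat k"
        using that by auto
      then have e: "z ^ nat (int d + j - k) = z ^ (d - nat k) * z ^ nat j"
        and "z ^ d = z ^ (d - nat k) * z ^ nat k"
        by (metis power_add)+
      moreover have "z ^ nat k * cnj (z ^ nat k) = 1"
        using z by (simp only: complex_norm_square [symmetric] norm_power) simp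
      ultimately show ?thesis by (simp add: ac_simps)
    qed
    then show ?thesis
      unfolding P_def poly_sum poly_monom sum_distrib_left
      by (intro sum.cong refl) (simp add: ac_simps)
  qed
  have coeffP: "coeff P (nat (int d + l)) = c l" if l: "- int d \<le> l" for l
  proof -
    \<comment> \<open>The bound on \<open>l\<close> matters: \<open>nat\<close> would identify all smaller \<open>l\<close> with \<open>- d\<close>.\<close>
    have "coeff P (nat (int d + l))
        = (\<Sum>j\<in>?I. \<Sum>k\<in>?I. if j = k + l then B j k else 0)"
      unfolding P_def coeff_sum coeff_monom
      using l by (intro sum.cong refl if_cong) (auto simp: nat_eq_iff)
    also have "\<dots> = (\<Sum>k\<in>?I. \<Sum>j\<in>?I. if j = k + l then B j k else 0)"
      by (rule sum.swap)
    also have "\<dots> = (\<Sum>k\<in>?I. B (k + l) k)"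
      by (intro sum.cong refl) (use out in \<open>auto simp: sum.delta\<close>)
    also have "\<dots> = (\<Sum>k\<in>{0..int d - l} \<inter> ?I. B (k + l) k)"
      by (rule sum.mono_neutral_right) (auto intro!: out)
    also have "\<dots> = c l"
      unfolding c_def by (rule sum.mono_neutral_left) (auto intro!: out)
    finally show ?thesis .
  qed
  have c_out: "c l = 0" if "l < - int d" for l
    unfolding c_def by (rule sum.neutral) (use that in \<open>auto intro!: out\<close>)
  have "(\<forall>z. norm z = 1 \<longrightarrow> ?F z = 1) \<longleftrightarrow> (\<forall>z. norm z = 1 \<longrightarrow> poly P z = poly (monom 1 d) z)"
    by (auto simp: polyP poly_monom)
  also have "\<dots> \<longleftrightarrow> P = monom 1 d"
    using poly_eqI_circle [of P "monom 1 d"] by auto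
  also have "\<dots> \<longleftrightarrow> (\<forall>l. c l = (if l = 0 then 1 else 0))"
  proof
    assume P: "P = monom 1 d"
    show "\<forall>l. c l = (if l = 0 then 1 else 0)"
    proof
      fix l
      show "c l = (if l = 0 then 1 else 0)"
      proof (cases "l < - int d")
        case False
        then have "c l = coeff (monom 1 d) (nat (int d + l))"
          using coeffP [of l] P by simp
        also have "\<dots> = (if l = 0 then 1 else 0)"
          using False by (auto simp: coeff_monom)
        finally show ?thesis .
      qed (auto simp: c_out)
    qed
  next
    assume c: "\<forall>l. c l = (if l = 0 then 1 else 0)"
    show "P = monom 1 d"
    proof (rule poly_eqI)
      fix n
      have "coeff P n = c (int n - int d)"
        using coeffP [of "int n - int d"] by simp
      then show "coeff P n = coeff (monom 1 d) n" using c by (auto simp: coeff_monom)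
    qed
  qed
  also have "\<dots> \<longleftrightarrow> c 0 = 1 \<and> (\<forall>l. l \<noteq> 0 \<longrightarrow> c l = 0)" by auto
  finally show ?thesis by (simp add: c_def)
qed

lemma peval_eq_sum_pcoeff:
  assumes "\<forall>i. degree (f $ i) \<le> d"
  shows "peval f z = (\<Sum>j\<in>{0..int d}. z ^ nat j *s pcoeff f (nat j))"
proof -
  have "poly (f $ i) z = (\<Sum>j\<in>{0..int d}. z ^ nat j * coeff (f $ i) (nat j))" for i
  proof -
    have "poly (f $ i) z = (\<Sum>j\<le>d. z ^ j * coeff (f $ i) j)"
      unfolding poly_altdef using assms
      by (intro sum.mono_neutral_cong_left) (auto simp: coeff_eq_0 mult.commute)
    also have "\<dots> = (\<Sum>j\<in>{0..int d}. z ^ nat j * coeff (f $ i) (nat j))"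
      by (rule sum.reindex_bij_witness [of _ nat int]) auto
    finally show ?thesis .
  qed
  then show ?thesis by (simp add: peval_def pcoeff_def vec_eq_iff)
qed

lemma pcoeff_sphere_map_eq_0:
  assumes "f \<in> sphere_maps d" "j > d"
  shows "pcoeff f j = 0"
proof -
  have "degree (f $ i) < j" for i
    using assms by (auto simp: sphere_maps_def intro: le_less_trans)
  then show ?thesis by (simp add: pcoeff_def vec_eq_iff coeff_eq_0)
qed

lemma gram_matrix_nonneg_hermitian: "gram_matrix d f \<in> nonneg_hermitian d"
proof -
  have "0 \<le> Re (\<Sum>j\<in>{0..int d}. \<Sum>k\<in>{0..int d}. cnj (x j) * gram_matrix d f j k * x k)" for x
  proof -
    let ?v = "\<Sum>j\<in>{0..int d}. cnj (x j) *s pcoeff f (nat j)"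
    have "(\<Sum>j\<in>{0..int d}. \<Sum>k\<in>{0..int d}. cnj (x j) * gram_matrix d f j k * x k)
        = cinner_vec ?v ?v"
      unfolding cinner_vec_linear_combinations
      by (intro sum.cong refl) (simp add: gram_matrix_def)
    then show ?thesis by (simp add: cinner_vec_self)
  qed
  then show ?thesis
    by (auto simp: nonneg_hermitian_def hermitian_matrices_def square_matrices_def gram_matrix_def
        cinner_vec_commute [symmetric])
qed

lemma sphere_map_iff_gram_matrix_in_W:
  assumes "\<forall>i. degree (f $ i) \<le> d"
  shows "f \<in> sphere_maps d \<longleftrightarrow> gram_matrix d f \<in> W d"
proof -
  let ?F = "\<lambda>z. \<Sum>j\<in>{0..int d}. \<Sum>k\<in>{0..int d}. z ^ nat j * cnj (z ^ nat k) * gram_matrix d f j k"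
  have "of_real ((norm (peval f z))\<^sup>2) = ?F z" for z
    unfolding cinner_vec_self [symmetric] peval_eq_sum_pcoeff [OF assms]
      cinner_vec_linear_combinations
    by (intro sum.cong refl) (simp add: gram_matrix_def)
  then have "norm (peval f z) = 1 \<longleftrightarrow> ?F z = 1" for z
    by (metis norm_ge_zero of_real_1 of_real_eq_iff one_power2 power2_eq_imp_eq zero_le_one)
  moreover have "gram_matrix d f \<in> square_matrices d"
    by (simp add: square_matrices_def gram_matrix_def)
  ultimately show ?thesis
    using assms gram_matrix_nonneg_hermitian [of d f] circle_form_eq_1_iff [of "gram_matrix d f" d]
    by (simp add: sphere_maps_def W_def)
qed

corollary gram_matrix_in_W: "f \<in> sphere_maps d \<Longrightarrow> gram_matrix d f \<in> W d"
  using sphere_map_iff_gram_matrix_in_W by (auto simp: sphere_maps_def)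

text \<open>
  The factorization gives vectors indexed by the \<open>d + 1\<close> matrix indices; the dimension
  hypothesis allows these to be identified with the coordinates of the target.
\<close>

lemma gram_matrix_surj:
  assumes card: "CARD('n::finite) = d + 1" and B: "B \<in> W d"
  shows "\<exists>f \<in> (sphere_maps d :: (complex poly ^ 'n) set). gram_matrix d f = B"
proof -
  let ?I = "{0..int d}"
  have nn: "B \<in> nonneg_hermitian d" using B by (simp add: W_def)
  have "\<exists>L::int \<Rightarrow> int \<Rightarrow> complex. \<forall>j\<in>?I. \<forall>k\<in>?I. B j k = (\<Sum>i\<in>?I. L j i * cnj (L k i))"
  proof (rule psd_imp_gram)
    show "B k j = cnj (B j k)" for j k
      using nn unfolding nonneg_hermitian_def hermitian_matrices_def by blast
    show "0 \<le> Re (\<Sum>j\<in>?I. \<Sum>k\<in>?I. cnj (x j) * B j k * x k)" for x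
      using nn unfolding nonneg_hermitian_def by blast
  qed simp
  then obtain L where L: "\<And>j k. j \<in> ?I \<Longrightarrow> k \<in> ?I \<Longrightarrow> B j k = (\<Sum>i\<in>?I. L j i * cnj (L k i))"
    by blast
  have "card (UNIV :: 'n set) = card ?I" using card by simp
  then obtain h where h: "bij_betw h (UNIV :: 'n set) ?I"
    using finite_same_card_bij [of "UNIV :: 'n set" ?I] by auto
  define f :: "complex poly ^ 'n" where "f = (\<chi> i. \<Sum>j\<le>d. monom (L (int j) (h i)) j)"
  have cf: "coeff (f $ i) n = (if n \<le> d then L (int n) (h i) else 0)" for i n
    by (simp add: f_def coeff_sum coeff_monom)
  have deg: "\<forall>i. degree (f $ i) \<le> d"
    by (auto intro!: degree_le simp: cf)
  have "gram_matrix d f j k = B j k" for j k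
  proof (cases "j \<in> ?I \<and> k \<in> ?I")
    case True
    then have "gram_matrix d f j k = (\<Sum>i\<in>UNIV. L j (h i) * cnj (L k (h i)))"
      by (simp add: gram_matrix_def cinner_vec_def pcoeff_def cf nat_le_iff)
    also have "\<dots> = (\<Sum>i\<in>?I. L j i * cnj (L k i))"
      by (rule sum.reindex_bij_betw [OF h])
    finally show ?thesis using L True by simp
  next
    case False
    then have "gram_matrix d f j k = 0"
      unfolding gram_matrix_def by (rule if_not_P)
    moreover have "B j k = 0"
      using nn False unfolding nonneg_hermitian_def hermitian_matrices_def square_matrices_def
      by blast
    ultimately show ?thesis by simp
  qed
  then have gram: "gram_matrix d f = B" by (intro ext)
  then have "f \<in> sphere_maps d"
    using sphere_map_iff_gram_matrix_in_W [OF deg] B by (simp only:)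
  with gram show ?thesis by (rule bexI)
qed

section \<open>Unitary equivalence and *-equivalence\<close>

text \<open>
  Both sides of the functional equation are polynomial in \<open>z\<close>, hence equality on the circle
  can be read off from the coefficients.
\<close>

lemma unitarily_related_iff_pcoeff:
  fixes f g :: "complex poly ^ 'n"
  shows "(\<forall>z. norm z = 1 \<longrightarrow> peval f z = U *v peval g (cis \<phi> * z)) \<longleftrightarrow>
         (\<forall>j. pcoeff f j = U *v (cis \<phi> ^ j *s pcoeff g j))"
proof -
  define h where "h = (\<chi> i. \<Sum>l\<in>UNIV. smult (U $ i $ l) (pcompose (g $ l) [:0, cis \<phi>:]))"
  have ph: "peval h z = U *v peval g (cis \<phi> * z)" for z
    by (simp add: peval_def h_def matrix_vector_mult_def vec_eq_iff poly_sum poly_pcompose mult.commute)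
  have ch: "pcoeff h j = U *v (cis \<phi> ^ j *s pcoeff g j)" for j
    by (simp add: pcoeff_def h_def matrix_vector_mult_def vec_eq_iff coeff_sum coeff_pcompose_linear)
  have "(\<forall>z. norm z = 1 \<longrightarrow> peval f z = peval h z) \<longleftrightarrow> f = h"
  proof
    assume "\<forall>z. norm z = 1 \<longrightarrow> peval f z = peval h z"
    then show "f = h"
      by (auto simp: vec_eq_iff peval_def intro!: poly_eqI_circle)
  qed simp
  moreover have "(\<forall>j. pcoeff f j = pcoeff h j) \<longleftrightarrow> f = h"
    by (auto simp: pcoeff_def vec_eq_iff poly_eq_iff)
  ultimately show ?thesis by (simp add: ph ch)
qed

text \<open>
  For a fixed angle \<open>\<phi>\<close>, some unitary matrix carries the rotated coefficients of
  \<open>g\<close> to those of \<open>f\<close> exactly if the two families have the same Gram matrix. The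
  Gram matrix of the rotated family is that of \<open>g\<close> with the phase factors of
  *-equivalence, for \<open>\<theta> = - \<phi>\<close>.
\<close>

lemma unitary_equivalence_iff_star_equivalence:
  fixes f g :: "complex poly ^ 'n"
  assumes f: "f \<in> sphere_maps d" and g: "g \<in> sphere_maps d"
  shows "(f, g) \<in> unitary_equivalence d \<longleftrightarrow> (gram_matrix d f, gram_matrix d g) \<in> star_equivalence d"
proof -
  let ?I = "{0..int d}"
  define rot where "rot \<phi> j = cis \<phi> ^ nat j *s pcoeff g (nat j)" for \<phi> j
  have gram_rot: "cinner_vec (rot \<phi> j) (rot \<phi> (j + m))
      = exp (\<i> * of_int m * of_real (- \<phi>)) * gram_matrix d g j (j + m)"
    if "j \<in> ?I" "j + m \<in> ?I" for \<phi> j m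
  proof -
    have "cis \<phi> ^ nat j * cnj (cis \<phi> ^ nat (j + m)) = exp (\<i> * of_int m * of_real (- \<phi>))"
    proof -
      have "cis \<phi> ^ nat j * cnj (cis \<phi> ^ nat (j + m)) = cis (- (of_int m * \<phi>))"
        using that by (simp add: Complex.DeMoivre cis_cnj cis_mult algebra_simps)
      also have "\<dots> = exp (\<i> * of_int m * of_real (- \<phi>))"
        by (simp add: cis_conv_exp mult.assoc)
      finally show ?thesis .
    qed
    then show ?thesis
      unfolding rot_def cinner_vec_scale_left cinner_vec_scale_right mult.assoc [symmetric]
      using that by (simp add: gram_matrix_def mult.commute)
  qed
  have W: "gram_matrix d f \<in> W d" "gram_matrix d g \<in> W d"
    using f g by (simp_all add: gram_matrix_in_W)
  have zero: "pcoeff f j = 0" "pcoeff g j = 0" if "j > d" for j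
    using f g that by (simp_all add: pcoeff_sphere_map_eq_0)
  have all_j: "(\<forall>j. pcoeff f j = U *v (cis \<phi> ^ j *s pcoeff g j)) \<longleftrightarrow>
      (\<forall>j\<in>?I. U *v rot \<phi> j = pcoeff f (nat j))" (is "?A \<longleftrightarrow> ?B") for U \<phi>
  proof
    assume ?B
    show ?A
    proof
      fix j
      show "pcoeff f j = U *v (cis \<phi> ^ j *s pcoeff g j)"
      proof (cases "j \<le> d")
        case True
        then have "int j \<in> ?I" by simp
        with \<open>?B\<close> have "U *v rot \<phi> (int j) = pcoeff f (nat (int j))" by blast
        then show ?thesis by (simp add: rot_def)
      qed (simp add: zero)
    qed
  qed (simp add: rot_def)
  have star: "(gram_matrix d f, gram_matrix d g) \<in> star_equivalence d \<longleftrightarrow>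
      (\<exists>\<phi>. \<forall>j m. j \<in> ?I \<and> j + m \<in> ?I \<longrightarrow>
         gram_matrix d f j (j + m) = cinner_vec (rot \<phi> j) (rot \<phi> (j + m)))"
    (is "_ \<longleftrightarrow> ?R")
  proof
    assume "(gram_matrix d f, gram_matrix d g) \<in> star_equivalence d"
    then obtain \<theta> :: real where \<theta>: "\<And>j m. j \<in> ?I \<Longrightarrow> j + m \<in> ?I \<Longrightarrow>
        gram_matrix d f j (j + m) = exp (\<i> * of_int m * of_real \<theta>) * gram_matrix d g j (j + m)"
      unfolding star_equivalence_def star_equivalent_def by blast
    show ?R
      by (rule exI [of _ "- \<theta>"]) (simp add: gram_rot \<theta>)
  next
    assume ?R
    then obtain \<phi> where \<phi>: "\<And>j m. j \<in> ?I \<Longrightarrow> j + m \<in> ?I \<Longrightarrow>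
         gram_matrix d f j (j + m) = cinner_vec (rot \<phi> j) (rot \<phi> (j + m))" by blast
    have "star_equivalent d (gram_matrix d f) (gram_matrix d g)"
      unfolding star_equivalent_def
      by (rule exI [of _ "- \<phi>"]) (metis \<phi> gram_rot)
    then show "(gram_matrix d f, gram_matrix d g) \<in> star_equivalence d"
      using W by (simp add: star_equivalence_def)
  qed
  have gram_eq: "(\<exists>U\<in>unitary_group. \<forall>j\<in>?I. U *v rot \<phi> j = pcoeff f (nat j)) \<longleftrightarrow>
      (\<forall>j m. j \<in> ?I \<and> j + m \<in> ?I \<longrightarrow>
         gram_matrix d f j (j + m) = cinner_vec (rot \<phi> j) (rot \<phi> (j + m)))" (is "?A \<longleftrightarrow> ?B") for \<phi>
  proof
    assume ?A
    then show ?B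
      unfolding gram_matrix_def by (metis unitary_group_cinner_vec)
  next
    assume B: ?B
    show ?A
    proof (rule equal_gram_imp_unitary)
      show "cinner_vec (rot \<phi> j) (rot \<phi> k) = cinner_vec (pcoeff f (nat j)) (pcoeff f (nat k))"
        if "j \<in> ?I" "k \<in> ?I" for j k
        using B [rule_format, of j "k - j"] that by (simp add: gram_matrix_def)
    qed simp
  qed
  have "(f, g) \<in> unitary_equivalence d \<longleftrightarrow>
      (\<exists>\<phi>. \<exists>U\<in>unitary_group. \<forall>j\<in>?I. U *v rot \<phi> j = pcoeff f (nat j))"
    using f g by (simp add: unitary_equivalence_def unitarily_related_iff_pcoeff all_j) blast
  then show ?thesis by (simp only: gram_eq star)
qed

section \<open>Topology of the moduli space\<close>

lemma compact_space_pullback_topology: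
  assumes "compactin T (f ` A)"
  shows "compact_space (pullback_topology A f T)"
  unfolding compact_space_alt
proof (intro allI impI)
  fix \<U>
  assume \<U>: "(\<forall>U\<in>\<U>. openin (pullback_topology A f T) U) \<and>
    topspace (pullback_topology A f T) \<subseteq> \<Union> \<U>"
  have fA: "f ` A \<subseteq> topspace T" using assms by (rule compactin_subset_topspace)
  define \<V> where "\<V> = {V. openin T V \<and> f -` V \<inter> A \<in> \<U>}"
  have "f ` A \<subseteq> \<Union>\<V>"
  proof
    fix y assume "y \<in> f ` A"
    then obtain x where x: "x \<in> A" "y = f x" by blast
    then have "x \<in> topspace (pullback_topology A f T)"
      using fA by (auto simp: topspace_pullback_topology)
    then have "x \<in> \<Union>\<U>" using \<U> by blast
    then obtain U where U: "U \<in> \<U>" "x \<in> U" by blast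
    then obtain V where "openin T V" "U = f -` V \<inter> A"
      using \<U> by (auto simp: openin_pullback_topology)
    then show "y \<in> \<Union>\<V>" using U x by (auto simp: \<V>_def)
  qed
  then obtain \<F> where \<F>: "finite \<F>" "\<F> \<subseteq> \<V>" "f ` A \<subseteq> \<Union>\<F>"
    using assms unfolding compactin_def by (metis (no_types, lifting) \<V>_def mem_Collect_eq)
  show "\<exists>\<F>. finite \<F> \<and> \<F> \<subseteq> \<U> \<and> topspace (pullback_topology A f T) \<subseteq> \<Union> \<F>"
    using \<F> by (intro exI [of _ "(\<lambda>V. f -` V \<inter> A) ` \<F>"])
      (auto simp: \<V>_def topspace_pullback_topology image_subset_iff)
qed

text \<open>
  The trace of the Gram matrix is the sum of the squared norms of the coefficients, and it is 1.
\<close>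

lemma norm_pcoeff_sphere_map_le_1:
  assumes f: "f \<in> sphere_maps d"
  shows "norm (pcoeff f j) \<le> 1"
proof (cases "j \<le> d")
  case True
  have "gram_matrix d f \<in> W d"
    using f by (rule gram_matrix_in_W)
  then have "(\<Sum>k\<in>{0..int d}. gram_matrix d f k k) = 1" by (simp add: W_def)
  then have "complex_of_real (\<Sum>k\<in>{0..int d}. (norm (pcoeff f (nat k)))\<^sup>2) = of_real 1"
    by (simp add: gram_matrix_def cinner_vec_self)
  then have "(\<Sum>k\<in>{0..int d}. (norm (pcoeff f (nat k)))\<^sup>2) = 1"
    using of_real_eq_iff by blast
  moreover have "(norm (pcoeff f (nat (int j))))\<^sup>2 \<le> (\<Sum>k\<in>{0..int d}. (norm (pcoeff f (nat k)))\<^sup>2)"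
    using True by (intro member_le_sum) auto
  ultimately have "(norm (pcoeff f j))\<^sup>2 \<le> 1\<^sup>2" by simp
  then show ?thesis by (rule power2_le_imp_le) simp
next
  case False
  then have "pcoeff f j = 0"
    using f by (simp add: pcoeff_sphere_map_eq_0)
  then show ?thesis by simp
qed

text \<open>
  This description presents the coefficient sequences of sphere maps as a closed part of a product
  of balls, from which compactness can be read off.
\<close>

lemma pcoeff_image_sphere_maps:
  "pcoeff ` (sphere_maps d :: (complex poly ^ 'n) set) =
     {A. (\<forall>j. A j \<in> cball 0 1) \<and> (\<forall>j. j > d \<longrightarrow> A j = 0) \<and>
         (\<forall>z. norm z = 1 \<longrightarrow> norm (\<Sum>j\<in>{0..int d}. z ^ nat j *s A (nat j)) = 1)}"
    (is "_ = ?S")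
proof (intro subset_antisym subsetI)
  fix A :: "nat \<Rightarrow> complex ^ 'n" assume "A \<in> pcoeff ` sphere_maps d"
  then obtain f where f: "f \<in> sphere_maps d" "A = pcoeff f" by blast
  then have "pcoeff f j = 0" if "j > d" for j
    using that by (simp add: pcoeff_sphere_map_eq_0)
  then show "A \<in> ?S"
    using f norm_pcoeff_sphere_map_le_1 [OF f(1)] peval_eq_sum_pcoeff [of f d]
    by (simp add: sphere_maps_def)
next
  fix A :: "nat \<Rightarrow> complex ^ 'n" assume A: "A \<in> ?S"
  define f where "f = (\<chi> i. \<Sum>j\<le>d. monom (A j $ i) j)"
  have cf: "coeff (f $ i) n = (if n \<le> d then A n $ i else 0)" for i n
    by (simp add: f_def coeff_sum coeff_monom)
  have deg: "\<forall>i. degree (f $ i) \<le> d" by (auto intro!: degree_le simp: cf)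
  have "pcoeff f = A" using A by (auto simp: pcoeff_def cf fun_eq_iff vec_eq_iff)
  moreover have "f \<in> sphere_maps d"
    using A deg peval_eq_sum_pcoeff [OF deg] \<open>pcoeff f = A\<close> by (simp add: sphere_maps_def)
  ultimately show "A \<in> pcoeff ` sphere_maps d" by blast
qed

lemma continuous_on_cinner_vec [continuous_intros]:
  assumes "continuous_on S f" "continuous_on S g"
  shows "continuous_on S (\<lambda>x. cinner_vec (f x) (g x))"
  unfolding cinner_vec_def using assms by (intro continuous_intros)

lemma compact_space_sphere_map_topology:
  "compact_space (sphere_map_topology d :: (complex poly ^ 'n) topology)"
  unfolding sphere_map_topology_def
proof (rule compact_space_pullback_topology)
  let ?box = "{A :: nat \<Rightarrow> complex ^ 'n. \<forall>j. A j \<in> cball 0 1}"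
  let ?zero = "{A :: nat \<Rightarrow> complex ^ 'n. \<forall>j. j > d \<longrightarrow> A j = 0}"
  let ?sph = "{A :: nat \<Rightarrow> complex ^ 'n.
    \<forall>z. norm z = 1 \<longrightarrow> norm (\<Sum>j\<in>{0..int d}. z ^ nat j *s A (nat j)) = 1}"
  have "compactin (product_topology (\<lambda>_. euclidean) UNIV) (PiE UNIV (\<lambda>_::nat. cball (0::complex ^ 'n) 1))"
    by (simp add: compactin_PiE)
  then have "compact ?box"
    by (simp add: euclidean_product_topology PiE_def Pi_def)
  moreover have "closed ?zero"
    by (intro closed_Collect_all closed_Collect_imp closed_Collect_eq open_Collect_const
        continuous_on_product_coordinates continuous_on_const)
  moreover have "closed ?sph"
  proof -
    have "continuous_on UNIV (\<lambda>A :: nat \<Rightarrow> complex ^ 'n. z ^ nat j *s A (nat j))" for z j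
      unfolding vector_scalar_mult_def by (intro continuous_intros continuous_on_product_coordinates)
    then show ?thesis
      by (intro closed_Collect_all closed_Collect_imp closed_Collect_eq open_Collect_const
          continuous_on_norm continuous_on_sum continuous_on_const)
  qed
  ultimately have "compact (?box \<inter> (?zero \<inter> ?sph))"
    by (intro compact_Int_closed closed_Int)
  moreover have "?box \<inter> (?zero \<inter> ?sph) = pcoeff ` (sphere_maps d :: (complex poly ^ 'n) set)"
    unfolding pcoeff_image_sphere_maps by blast
  ultimately show "compactin euclidean (pcoeff ` (sphere_maps d :: (complex poly ^ 'n) set))"
    by simp
qed

lemma continuous_map_gram_matrix:
  "continuous_map (sphere_map_topology d :: (complex poly ^ 'n) topology) (top_of_set (W d))
     (gram_matrix d)"
proof -
  define G where "G A j k = (if j \<in> {0..int d} \<and> k \<in> {0..int d}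
      then cinner_vec (A (nat j)) (A (nat k)) else 0)" for A :: "nat \<Rightarrow> complex ^ 'n" and j k
  have "continuous_on UNIV (\<lambda>A. G A j k)" for j k
    unfolding G_def
    by (cases "j \<in> {0..int d} \<and> k \<in> {0..int d}") (auto intro!: continuous_intros)
  then have "continuous_on UNIV G"
    by (intro continuous_on_coordinatewise_then_product)
  then have "continuous_map euclidean euclidean G" by simp
  then have "continuous_map (sphere_map_topology d) euclidean (G \<circ> pcoeff)"
    unfolding sphere_map_topology_def by (rule continuous_map_pullback)
  moreover have "G \<circ> pcoeff = gram_matrix d"
    by (simp add: G_def gram_matrix_def fun_eq_iff)
  ultimately show ?thesis
    by (simp add: continuous_map_in_subtopology Pi_def image_subset_iff gram_matrix_in_W)
qed

text \<open>
  A continuous surjection from a compact space to a Hausdorff space is closed, hence a quotient map.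
\<close>

lemma quotient_map_gram_matrix:
  assumes "CARD('n::finite) = d + 1"
  shows "quotient_map (sphere_map_topology d :: (complex poly ^ 'n) topology) (top_of_set (W d))
     (gram_matrix d)"
proof (rule continuous_imp_quotient_map)
  show "continuous_map (sphere_map_topology d :: (complex poly ^ 'n) topology) (top_of_set (W d))
     (gram_matrix d)"
    by (rule continuous_map_gram_matrix)
  show "gram_matrix d ` topspace (sphere_map_topology d :: (complex poly ^ 'n) topology)
      = topspace (top_of_set (W d))"
    using gram_matrix_surj [OF assms] gram_matrix_in_W by (auto simp: image_iff)
qed (simp_all add: compact_space_sphere_map_topology Hausdorff_space_subtopology)

lemma quotient_maps_same_fibres_homeomorphic:
  assumes p: "quotient_map X Y p" and q: "quotient_map X Z q"
    and fibres: "\<And>x y. x \<in> topspace X \<Longrightarrow> y \<in> topspace X \<Longrightarrow> p x = p y \<longleftrightarrow> q x = q y"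
  obtains h where "homeomorphic_map Y Z h" "\<And>x. x \<in> topspace X \<Longrightarrow> h (p x) = q x"
proof -
  obtain h where h: "\<And>x. x \<in> topspace X \<Longrightarrow> h (p x) = q x"
    using quotient_map_lift_exists [OF p quotient_imp_continuous_map [OF q]] fibres by metis
  have "quotient_map X Z (h \<circ> p)"
    using q h by (auto intro: quotient_map_eq)
  then have "quotient_map Y Z h" by (simp only: quotient_map_compose_eq [OF p])
  moreover have "inj_on h (topspace Y)"
  proof (rule inj_onI)
    fix y y' assume y: "y \<in> topspace Y" "y' \<in> topspace Y" and eq: "h y = h y'"
    then obtain x x' where "x \<in> topspace X" "x' \<in> topspace X" "y = p x" "y' = p x'"
      unfolding quotient_imp_surjective_map [OF p, symmetric] by blast
    with eq show "y = y'" by (simp add: h fibres)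
  qed
  ultimately have "homeomorphic_map Y Z h" by (simp add: homeomorphic_map_def)
  then show ?thesis using h by (rule that)
qed

theorem corollary4p2:
  fixes d :: nat
  assumes "CARD('n::finite) = d + 1"
  shows "\<exists>\<Phi> :: (complex poly ^ 'n) set \<Rightarrow> (int \<Rightarrow> int \<Rightarrow> complex) set.
           homeomorphic_map
             (quotient_topology (sphere_map_topology d) (unitary_equivalence d))
             (quotient_topology (top_of_set (W d)) (star_equivalence d)) \<Phi> \<and>
           (\<forall>f\<in>sphere_maps d.
              \<Phi> (unitary_equivalence d `` {f}) = star_equivalence d `` {gram_matrix d f})"
proof -
  let ?X = "sphere_map_topology d :: (complex poly ^ 'n) topology"
  let ?p = "\<lambda>f :: complex poly ^ 'n. unitary_equivalence d `` {f}"
  let ?q = "(\<lambda>B. star_equivalence d `` {B}) \<circ> gram_matrix d"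
  have q: "quotient_map ?X (quotient_topology (top_of_set (W d)) (star_equivalence d)) ?q"
    using quotient_map_gram_matrix [OF assms] quotient_map_quotient_topology
    by (rule quotient_map_compose)
  have fibres: "?p f = ?p g \<longleftrightarrow> ?q f = ?q g" if fg: "f \<in> topspace ?X" "g \<in> topspace ?X" for f g
  proof -
    have "gram_matrix d f \<in> W d" "gram_matrix d g \<in> W d"
      using fg by (simp_all add: gram_matrix_in_W)
    then show ?thesis
      using fg unitary_equivalence_iff_star_equivalence [of f d g]
      by (simp add: eq_equiv_class_iff [OF equiv_unitary_equivalence]
          eq_equiv_class_iff [OF equiv_star_equivalence])
  qed
  obtain \<Phi> where "homeomorphic_map (quotient_topology ?X (unitary_equivalence d))
      (quotient_topology (top_of_set (W d)) (star_equivalence d)) \<Phi>"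
    "\<And>f. f \<in> topspace ?X \<Longrightarrow> \<Phi> (?p f) = ?q f"
    using quotient_maps_same_fibres_homeomorphic [OF quotient_map_quotient_topology q fibres]
    by metis
  then show ?thesis
    unfolding topspace_sphere_map_topology comp_apply by (intro exI conjI ballI)
qed

end
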